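(* Let $s\geq 2$ be an integer congruent to $1$ or $2$ modulo $3$. Then \[\pi(S(K_s^{(2)}))\geq 1-\frac{2}{s},\] where $S(K_s^{(2)})$ is the suspension of the complete 2-graph on $s$ vertices and $\pi$ denotes Turán density.
   Context: A 3-graph is a pair $G=(V,E)$ with $V$ a finite vertex set and $E$ a set of 3-element subsets of $V$ (the 3-edges). A 3-graph contains another 3-graph $F$ as a subgraph if it has a (not necessarily induced) subgraph isomorphic to $F$. A 2-graph is an ordinary graph; $K_s^{(2)}$ is the complete 2-graph on $s$ vertices. For a 2-graph $H$, its suspension $S(H)$ is the 3-graph with vertex set $V(H)\sqcup\{x_\star\}$ and 3-edges $\{x_\star vv': vv'\in E(H)\}$. For a non-empty 3-graph $F$ (one having at least one 3-edge), the Turán number $\mathrm{ex}(n,F)$ is the maximum number of 3-edges in an $n$-vertex 3-graph not containing $F$ as a subgraph, and the Turán density is $\pi(F)=\lim_{n\to\infty}\mathrm{ex}(n,F)/\binom{n}{3}$ (the limit exists since the sequence is monotone decreasing). *)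

theory Defs
  imports Complex_Main "HOL-Library.Ramsey"
begin

type_synonym 'a hypergraph = "'a set \<times> 'a set set"

abbreviation verts :: "'a hypergraph \<Rightarrow> 'a set" where
  "verts G \<equiv> fst G"

abbreviation edges :: "'a hypergraph \<Rightarrow> 'a set set" where
  "edges G \<equiv> snd G"

definition uniform_graph :: "nat \<Rightarrow> 'a hypergraph \<Rightarrow> bool" where
  "uniform_graph k G \<longleftrightarrow> finite (verts G) \<and> edges G \<subseteq> nsets (verts G) k"

definition subgraph :: "'a hypergraph \<Rightarrow> 'a hypergraph \<Rightarrow> bool" where
  "subgraph H G \<longleftrightarrow> verts H \<subseteq> verts G \<and> edges H \<subseteq> edges G"

definition isomorphic :: "'a hypergraph \<Rightarrow> 'b hypergraph \<Rightarrow> bool" where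
  "isomorphic F H \<longleftrightarrow> (\<exists>f. bij_betw f (verts F) (verts H) \<and> edges H = (`) f ` edges F)"

definition contains :: "'b hypergraph \<Rightarrow> 'a hypergraph \<Rightarrow> bool" where
  "contains G F \<longleftrightarrow> (\<exists>H. subgraph H G \<and> isomorphic F H)"

definition complete_graph :: "nat \<Rightarrow> nat hypergraph" where
  "complete_graph s = ({..<s}, nsets {..<s} 2)"

text \<open>\<^term>\<open>None\<close> plays the role of the new vertex.\<close>

definition suspension :: "'a hypergraph \<Rightarrow> 'a option hypergraph" where
  "suspension H = (insert None (Some ` verts H), (\<lambda>e. insert None (Some ` e)) ` edges H)"

text \<open>Every finite graph has an isomorphic copy on a set of natural numbers, so host graphs
  with vertices in \<^typ>\<open>nat\<close> suffice. If \<open>F\<close> has an edge, the set below is finite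
  and non-empty.\<close>

definition turan_number :: "nat \<Rightarrow> 'a hypergraph \<Rightarrow> nat" where
  "turan_number n F =
     Max {card (edges G) | G :: nat hypergraph.
            uniform_graph 3 G \<and> card (verts G) = n \<and> \<not> contains G F}"

definition turan_density :: "'a hypergraph \<Rightarrow> real" where
  "turan_density F = lim (\<lambda>n. real (turan_number n F) / real (n choose 3))"

lemma uniform_graph_complete_graph: "uniform_graph 2 (complete_graph s)"
  by (simp add: uniform_graph_def complete_graph_def)

lemma uniform_graph_suspension:
  assumes "uniform_graph k H"
  shows "uniform_graph (Suc k) (suspension H)"
proof -
  have "insert None (Some ` e) \<in> nsets (verts (suspension H)) (Suc k)" if "e \<in> edges H" for e
  proof -
    have "e \<subseteq> verts H" "finite e" "card e = k"
      using assms that by (auto simp: uniform_graph_def nsets_def)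
    moreover have "card (Some ` e) = card e"
      by (simp add: card_image)
    ultimately show ?thesis
      unfolding nsets_def suspension_def by auto
  qed
  then show ?thesis
    using assms by (auto simp: uniform_graph_def suspension_def)
qed

lemma finite_turan_number_set:
  "finite {card (edges G) | G :: nat hypergraph.
            uniform_graph 3 G \<and> card (verts G) = n \<and> \<not> contains G F}"
proof (rule finite_subset[OF _ finite_atMost])
  have "card (edges G) \<le> card (verts G) choose 3"
    if "uniform_graph 3 G" for G :: "nat hypergraph"
    unfolding card_nsets[symmetric]
    by (rule card_mono) (use that in \<open>simp_all add: uniform_graph_def finite_imp_finite_nsets\<close>)
  then show "{card (edges G) | G :: nat hypergraph.
            uniform_graph 3 G \<and> card (verts G) = n \<and> \<not> contains G F} \<subseteq> {..n choose 3}"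
    by blast
qed

lemma turan_number_set_nonempty:
  assumes "edges F \<noteq> {}"
  shows "{card (edges G) | G :: nat hypergraph.
            uniform_graph 3 G \<and> card (verts G) = n \<and> \<not> contains G F} \<noteq> {}"
proof -
  have "uniform_graph 3 ({..<n}, {})" "\<not> contains ({..<n}, {}) F"
    using assms by (auto simp: uniform_graph_def contains_def subgraph_def isomorphic_def)
  moreover have "card (verts ({..<n}, {})) = n"
    by simp
  ultimately show ?thesis
    by blast
qed

end

theory Submission imports Defs begin

text \<open>Put \<open>m = 2 s - 1\<close>. The condition on \<open>s\<close> says that \<open>m\<close> is \<open>1\<close> or \<open>3\<close> modulo \<open>6\<close>, so there is a
  Steiner triple system on \<open>m\<close> points. Let \<open>P\<close> be the 3-graph of all triples that are not
  blocks. The link of a point in \<open>P\<close> is the complete graph on the other \<open>2 (s - 1)\<close> points minus a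
  perfect matching, so it has no clique of size \<open>s\<close>. This property survives iterated blow-ups:
  the link of a vertex is the disjoint union of a blow-up of a link in \<open>P\<close> and of a link in the
  part containing the vertex. The density of the iterated blow-up tends to
  \<open>(m - 3) / (m + 1) = 1 - 2 / s\<close>.\<close>

section \<open>Turan numbers and their monotone limit\<close>

lemma card_edges_le_turan_number:
  fixes G :: "nat hypergraph"
  assumes "uniform_graph 3 G" "\<not> contains G F"
  shows "card (edges G) \<le> turan_number (card (verts G)) F"
  unfolding turan_number_def
  by (rule Max_ge[OF finite_turan_number_set]) (intro CollectI exI[of _ G], simp add: assms)

lemma turan_number_attained:
  assumes "edges F \<noteq> {}"
  obtains G :: "nat hypergraph" where "uniform_graph 3 G" "card (verts G) = n"
    "\<not> contains G F" "card (edges G) = turan_number n F"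
proof -
  have "turan_number n F \<in> {card (edges G) | G :: nat hypergraph.
      uniform_graph 3 G \<and> card (verts G) = n \<and> \<not> contains G F}"
    unfolding turan_number_def
    by (rule Max_in[OF finite_turan_number_set turan_number_set_nonempty[OF assms]])
  then show ?thesis
    by (elim CollectE exE conjE) (rule that, assumption+, rule sym)
qed

lemma contains_mono:
  assumes "contains H F" "subgraph H G"
  shows "contains G F"
  using assms unfolding contains_def subgraph_def by blast

text \<open>Double counting of pairs of a vertex and an edge avoiding it in an extremal graph on
  \<open>Suc n\<close> vertices: \<open>n - 2\<close> vertices avoid a given edge, and deleting a
  vertex leaves a graph on \<open>n\<close> vertices without \<open>F\<close>.\<close>

lemma turan_number_Suc:
  assumes "edges F \<noteq> {}"
  shows "(n - 2) * turan_number (Suc n) F \<le> Suc n * turan_number n F"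
proof -
  obtain G :: "nat hypergraph" where G: "uniform_graph 3 G" "card (verts G) = Suc n"
    "\<not> contains G F" "card (edges G) = turan_number (Suc n) F"
    using turan_number_attained[OF assms] .
  let ?V = "verts G" and ?E = "edges G"
  have fin: "finite ?V" "finite ?E"
    using G(1) finite_subset[OF _ finite_imp_finite_nsets] by (auto simp: uniform_graph_def)
  have edge: "e \<subseteq> ?V" "finite e" "card e = 3" if "e \<in> ?E" for e
    using G(1) that by (auto simp: uniform_graph_def nsets_def)
  have "(\<Sum>v\<in>?V. card {e \<in> ?E. v \<notin> e}) = (n - 2) * card ?E"
  proof (rule sum_multicount[OF fin], rule ballI)
    fix e assume e: "e \<in> ?E"
    have "{v \<in> ?V. v \<notin> e} = ?V - e" by auto
    then show "card {v \<in> ?V. v \<notin> e} = n - 2"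
      using edge[OF e] G(2) by (simp add: card_Diff_subset)
  qed
  moreover have "card {e \<in> ?E. v \<notin> e} \<le> turan_number n F" if v: "v \<in> ?V" for v
  proof -
    let ?H = "(?V - {v}, {e \<in> ?E. v \<notin> e})"
    have "uniform_graph 3 ?H"
      using fin edge by (auto simp: uniform_graph_def nsets_def)
    moreover have "\<not> contains ?H F"
      using contains_mono[of ?H F G] G(3) by (auto simp: subgraph_def)
    ultimately show ?thesis
      using card_edges_le_turan_number[of ?H F] v fin G(2) by simp
  qed
  then have "(\<Sum>v\<in>?V. card {e \<in> ?E. v \<notin> e}) \<le> Suc n * turan_number n F"
    using sum_bounded_above[of ?V "\<lambda>v. card {e \<in> ?E. v \<notin> e}" "turan_number n F"] G(2) by simp
  ultimately show ?thesis
    using G(4) by simp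
qed

text \<open>Divide \<open>turan_number_Suc\<close> by
  \<open>(n - 2) * (Suc n choose 3) = Suc n * (n choose 3)\<close>.\<close>

lemma turan_ratio_antimono:
  assumes "edges F \<noteq> {}" "3 \<le> m" "m \<le> n"
  shows "real (turan_number n F) / real (n choose 3) \<le> real (turan_number m F) / real (m choose 3)"
  using assms(3)
proof (induction n rule: dec_induct)
  case (step n)
  let ?t = "\<lambda>n. real (turan_number n F)" and ?c = "\<lambda>n. real (n choose 3)"
  have pos: "real (n - 2) > 0" "?c n \<ge> 0" "?c (Suc n) \<ge> 0"
    using step.hyps assms(2) by simp_all
  have "(Suc n - 3) * (Suc n choose 3) = Suc n * (n choose 3)"
    using binomial_absorb_comp[of "Suc n" 3] by (simp only: diff_Suc_1)
  then have "real ((n - 2) * (Suc n choose 3)) = real (Suc n * (n choose 3))"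
    by (simp only: diff_Suc_Suc numeral_3_eq_3 numeral_2_eq_2)
  then have c: "real (n - 2) * ?c (Suc n) = real (Suc n) * ?c n"
    by (simp only: of_nat_mult)
  have "real ((n - 2) * turan_number (Suc n) F) \<le> real (Suc n * turan_number n F)"
    using turan_number_Suc[OF assms(1), of n] by (simp only: of_nat_le_iff)
  then have t: "real (n - 2) * ?t (Suc n) \<le> real (Suc n) * ?t n"
    by (simp only: of_nat_mult)
  have "?t (Suc n) / ?c (Suc n) = (real (n - 2) * ?t (Suc n)) / (real (n - 2) * ?c (Suc n))"
    using pos(1) by (intro mult_divide_mult_cancel_left[symmetric]) simp
  also have "\<dots> \<le> (real (Suc n) * ?t n) / (real (n - 2) * ?c (Suc n))"
    using t pos by (intro divide_right_mono mult_nonneg_nonneg) simp_all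
  also have "\<dots> = ?t n / ?c n"
    unfolding c by (intro mult_divide_mult_cancel_left) simp
  finally show ?case using step.IH by linarith
qed simp

text \<open>By monotonicity a bound at arbitrarily large orders holds at every order from 3 on, so
  constructions on \<open>m ^ k\<close> vertices suffice.\<close>

lemma turan_density_ge:
  assumes "edges F \<noteq> {}"
    and cofinal: "\<And>N. \<exists>n\<ge>N. real (turan_number n F) / real (n choose 3) \<ge> c"
  shows "turan_density F \<ge> c"
proof -
  let ?a = "\<lambda>n. real (turan_number n F) / real (n choose 3)"
  \<comment> \<open>For \<open>n < 3\<close> the quotient is \<open>0\<close> by the convention for
    division by zero, hence the shift by 3.\<close>
  have "decseq (\<lambda>n. ?a (n + 3))"
    unfolding decseq_def using turan_ratio_antimono[OF assms(1)] by simp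
  then obtain L where "(\<lambda>n. ?a (n + 3)) \<longlonglongrightarrow> L"
    using decseq_convergent[of "\<lambda>n. ?a (n + 3)" 0] by auto
  then have lim: "?a \<longlonglongrightarrow> L" by (rule LIMSEQ_offset)
  have "c \<le> ?a n" if "n \<ge> 3" for n
    using cofinal[of n] turan_ratio_antimono[OF assms(1) that] by (meson order_trans)
  then have "c \<le> L" using LIMSEQ_le_const[OF lim] by blast
  then show ?thesis
    using limI[OF lim] by (simp add: turan_density_def)
qed

section \<open>Steiner quasigroups\<close>

text \<open>The operation sends a pair of distinct points to the third point of the block through
  them, so that the blocks form a Steiner triple system.\<close>

definition steiner_quasigroup_on :: "'a set \<Rightarrow> ('a \<Rightarrow> 'a \<Rightarrow> 'a) \<Rightarrow> bool" where
  "steiner_quasigroup_on A f \<longleftrightarrow> (\<forall>a\<in>A. f a a = a \<and>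
     (\<forall>b\<in>A. f a b \<in> A \<and> f a b = f b a \<and> f a (f a b) = b))"

text \<open>Conjugation by an enumeration; the blow-up uses the points as base \<open>m\<close>
  digits.\<close>

lemma steiner_quasigroup_on_transfer:
  assumes "steiner_quasigroup_on A f" "finite A"
  obtains g where "steiner_quasigroup_on {..<card A} g"
proof -
  obtain h where h: "bij_betw h A {..<card A}"
    using assms(2) ex_bij_betw_finite_nat[of A] by (auto simp: atLeast0LessThan)
  define k where "k = inv_into A h"
  have k: "bij_betw k {..<card A} A"
    using bij_betw_inv_into[OF h] by (simp add: k_def)
  have [simp]: "k (h a) = a" if "a \<in> A" for a
    using bij_betw_inv_into_left[OF h that] by (simp add: k_def)
  have [simp]: "h (k i) = i" if "i < card A" for i
    using bij_betw_inv_into_right[OF h] that by (simp add: k_def)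
  have mem: "k i \<in> A" if "i < card A" for i using bij_betwE[OF k] that by simp
  have mem': "h a < card A" if "a \<in> A" for a using bij_betwE[OF h] that by simp
  have "steiner_quasigroup_on {..<card A} (\<lambda>i j. h (f (k i) (k j)))"
    using assms(1) mem mem' unfolding steiner_quasigroup_on_def by simp
  then show ?thesis by (rule that)
qed

text \<open>A relabelling of addition modulo \<open>q\<close> for which \<open>x \<circ> x = x\<close> holds for all \<open>x\<close> if \<open>q\<close> is
  odd, and for the lower half of the residues if \<open>q\<close> is even.\<close>

definition half_mod :: "nat \<Rightarrow> nat \<Rightarrow> nat" where
  "half_mod q n = (if even n then n div 2 else n div 2 + Suc q div 2)"

definition unhalf_mod :: "nat \<Rightarrow> nat \<Rightarrow> nat" where
  "unhalf_mod q n = (if n < Suc q div 2 then 2 * n else 2 * (n - Suc q div 2) + 1)"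

text \<open>For odd \<open>q\<close> this is the midpoint: \<open>x + y\<close> times the inverse of
  2 modulo \<open>q\<close>.\<close>

definition mid :: "nat \<Rightarrow> nat \<Rightarrow> nat \<Rightarrow> nat" where
  "mid q x y = half_mod q ((x + y) mod q)"

text \<open>Left division for \<open>mid\<close>. Adding \<open>q\<close> first keeps the
  subtraction from truncating when \<open>x < q\<close>.\<close>

definition unmid :: "nat \<Rightarrow> nat \<Rightarrow> nat \<Rightarrow> nat" where
  "unmid q x y = (unhalf_mod q y + q - x) mod q"

lemma mod_less_double:
  fixes n q :: nat
  assumes "n < 2 * q"
  shows "n mod q = (if n < q then n else n - q)"
  using assms by (simp add: mod_if)

lemma half_mod_less: "n < q \<Longrightarrow> half_mod q n < q"
  unfolding half_mod_def by (auto elim!: oddE evenE)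

lemma unhalf_mod_less: "n < q \<Longrightarrow> unhalf_mod q n < q"
  unfolding unhalf_mod_def by auto

lemma half_unhalf_mod: "half_mod q (unhalf_mod q n) = n"
  unfolding half_mod_def unhalf_mod_def by auto

lemma unhalf_half_mod: "n < q \<Longrightarrow> unhalf_mod q (half_mod q n) = n"
  unfolding half_mod_def unhalf_mod_def by (auto elim!: oddE evenE)

lemma mid_less: "x < q \<Longrightarrow> mid q x y < q"
  unfolding mid_def by (rule half_mod_less) simp

lemma unmid_less: "x < q \<Longrightarrow> unmid q x y < q"
  unfolding unmid_def by simp

lemma mid_commute: "mid q x y = mid q y x"
  by (simp add: mid_def add.commute)

lemma mid_unmid:
  assumes "x < q" "y < q"
  shows "mid q x (unmid q x y) = y"
proof -
  have "(x + unmid q x y) mod q = (unhalf_mod q y + q) mod q"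
    using assms by (simp add: unmid_def mod_simps)
  also have "\<dots> = unhalf_mod q y" using unhalf_mod_less[OF assms(2)] by simp
  finally show ?thesis by (simp add: mid_def half_unhalf_mod)
qed

lemma unmid_mid:
  assumes "x < q" "y < q"
  shows "unmid q x (mid q x y) = y"
proof -
  have "unhalf_mod q (mid q x y) = (x + y) mod q"
    using assms by (simp add: mid_def unhalf_half_mod)
  then show ?thesis
    using assms by (auto simp: unmid_def mod_less_double)
qed

text \<open>As \<open>mid\<close> is commutative, \<open>mid q x z = y\<close> also exhibits
  \<open>x\<close> as the quotient of \<open>y\<close> by \<open>z\<close>.\<close>

lemma unmid_unmid:
  assumes "x < q" "y < q"
  shows "unmid q (unmid q x y) y = x"
  using unmid_mid[of "unmid q x y" q x] mid_unmid[OF assms] assms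
  by (simp add: mid_commute unmid_less)

text \<open>Measures the failure of idempotence for even \<open>q\<close>: the pairs
  \<open>x\<close>, \<open>x - q div 2\<close> found here are those that blocks through
  \<open>None\<close> join.\<close>

lemma mid_self:
  assumes "x < q"
  shows "mid q x x = (if even q \<and> q div 2 \<le> x then x - q div 2 else x)"
  using assms unfolding mid_def half_mod_def by (auto simp: mod_less_double elim!: oddE evenE)

text \<open>Identifies the degenerate case of \<open>across\<close>, where left division returns
  \<open>x\<close> itself and so gives no third point.\<close>

lemma unmid_eq_self_iff:
  assumes "x < q" "y < q"
  shows "unmid q x y = x \<longleftrightarrow> y = mid q x x"
  using assms mid_unmid unmid_mid by metis

text \<open>The constructions of Bose (\<open>q\<close> odd, without the point \<open>None\<close>) and of Skolem (\<open>q\<close> even).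
  The block through \<open>(x, i)\<close> and \<open>(y, i + 1)\<close> is completed by \<open>across q i x y\<close>.\<close>

definition across :: "nat \<Rightarrow> nat \<Rightarrow> nat \<Rightarrow> nat \<Rightarrow> (nat \<times> nat) option" where
  "across q i x y = (if unmid q x y \<noteq> x then Some (unmid q x y, i)
     else if y = x then Some (x, (i + 2) mod 3) else None)"

text \<open>The blocks are \<open>{(x, i), (y, i), (mid q x y, i + 1)}\<close> for
  \<open>x \<noteq> y\<close>, \<open>{(x, 0), (x, 1), (x, 2)}\<close> for idempotent
  \<open>x\<close>, and \<open>{None, (x, i), (x - q div 2, i + 1)}\<close> for even
  \<open>q\<close> and \<open>x\<close> in the upper half. Levels count modulo 3.\<close>

fun bose_skolem :: "nat \<Rightarrow> (nat \<times> nat) option \<Rightarrow> (nat \<times> nat) option \<Rightarrow> (nat \<times> nat) option" where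
  "bose_skolem q None None = None"
| "bose_skolem q None (Some (x, i)) =
     (if x < q div 2 then Some (x + q div 2, (i + 2) mod 3) else Some (x - q div 2, (i + 1) mod 3))"
| "bose_skolem q (Some (x, i)) None =
     (if x < q div 2 then Some (x + q div 2, (i + 2) mod 3) else Some (x - q div 2, (i + 1) mod 3))"
| "bose_skolem q (Some (x, i)) (Some (y, j)) =
     (if i = j then if x = y then Some (x, i) else Some (mid q x y, (i + 1) mod 3)
      else if j = (i + 1) mod 3 then across q i x y else across q j y x)"

definition bose_skolem_points :: "nat \<Rightarrow> (nat \<times> nat) option set" where
  "bose_skolem_points q = Some ` ({..<q} \<times> {..<3}) \<union> (if even q then {None} else {})"

lemma card_bose_skolem_points:
  "finite (bose_skolem_points q)"
  "card (bose_skolem_points q) = 3 * q + (if even q then 1 else 0)"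
  by (auto simp: bose_skolem_points_def card_image card_insert_if)

lemma less_3_cases: "i < 3 \<Longrightarrow> i = 0 \<or> i = 1 \<or> i = (2::nat)" by auto

lemma bose_skolem_commute:
  assumes "a \<in> bose_skolem_points q" "b \<in> bose_skolem_points q"
  shows "bose_skolem q a b = bose_skolem q b a"
  using assms unfolding bose_skolem_points_def
  by (auto simp: mid_commute split: if_splits dest!: less_3_cases)

lemma bose_skolem_closed:
  assumes "a \<in> bose_skolem_points q" "b \<in> bose_skolem_points q"
  shows "bose_skolem q a b \<in> bose_skolem_points q"
  using assms unfolding bose_skolem_points_def
  by (auto simp: across_def mid_less unmid_less unmid_eq_self_iff mid_self split: if_splits)

lemma bose_skolem_next:
  assumes "i < 3"
  shows "bose_skolem q (Some (x, i)) (Some (y, (i + 1) mod 3)) = across q i x y"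
    and "bose_skolem q (Some (y, (i + 1) mod 3)) (Some (x, i)) = across q i x y"
    and "bose_skolem q (Some (x, i)) (Some (x, (i + 2) mod 3)) = across q ((i + 2) mod 3) x x"
  using less_3_cases[OF assms] by auto

lemma across_eq:
  assumes "x < q" "y < q"
  shows "across q i x y = (if y \<noteq> mid q x x then Some (unmid q x y, i)
    else if even q \<and> q div 2 \<le> x then None else Some (x, (i + 2) mod 3))"
  using assms by (auto simp: across_def unmid_eq_self_iff mid_self)

text \<open>One case for each kind of block: through \<open>None\<close>, through the three copies
  of \<open>x\<close>, and generic, where \<open>mid\<close> undoes \<open>unmid\<close>.\<close>

lemma bose_skolem_across_left:
  assumes "x < q" "y < q" "i < 3"
  shows "bose_skolem q (Some (x, i)) (across q i x y) = Some (y, (i + 1) mod 3)"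
proof (cases "y = mid q x x")
  case y: True
  show ?thesis
  proof (cases "even q \<and> q div 2 \<le> x")
    case True
    then show ?thesis using y assms by (simp add: across_eq mid_self)
  next
    case False
    then have mid: "mid q x x = x" using assms(1) by (auto simp: mid_self)
    have "across q i x y = Some (x, (i + 2) mod 3)"
      using False y unfolding across_eq[OF assms(1,2)] by simp
    \<comment> \<open>Level \<open>i\<close> follows \<open>(i + 2) mod 3\<close> cyclically, so
      \<open>across\<close> now starts from the latter.\<close>
    then have "bose_skolem q (Some (x, i)) (across q i x y) = across q ((i + 2) mod 3) x x"
      by (simp only: bose_skolem_next(3)[OF assms(3)])
    also have "\<dots> = Some (x, (i + 1) mod 3)"
      using False mid less_3_cases[OF assms(3)] unfolding across_eq[OF assms(1,1)] by auto
    finally show ?thesis using y mid by simp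
  qed
next
  case False
  then have "unmid q x y \<noteq> x" using assms unmid_eq_self_iff by blast
  then show ?thesis using False assms by (simp add: across_eq mid_unmid)
qed

lemma bose_skolem_across_right:
  assumes "x < q" "y < q" "i < 3"
  shows "bose_skolem q (Some (y, (i + 1) mod 3)) (across q i x y) = Some (x, i)"
proof (cases "y = mid q x x")
  case y: True
  show ?thesis
  proof (cases "even q \<and> q div 2 \<le> x")
    case True
    then have "x - q div 2 < q div 2" using assms(1) by (auto elim!: evenE)
    then show ?thesis
      using True y assms less_3_cases[OF assms(3)]
      by (auto simp: across_eq mid_self)
  next
    case False
    then have mid: "mid q x x = x" using assms(1) by (auto simp: mid_self)
    then have "unmid q x x = x" using assms(1) unmid_eq_self_iff by simp
    then have "across q j x x = Some (x, (j + 2) mod 3)" for j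
      by (simp add: across_def)
    moreover have "y = x" using y mid by simp
    ultimately show ?thesis using less_3_cases[OF assms(3)] by auto
  qed
next
  case False
  let ?z = "unmid q x y"
  have z: "?z < q" "unmid q ?z y = x"
    using assms by (simp_all add: unmid_less unmid_unmid)
  have "?z \<noteq> x"
    using False unmid_eq_self_iff[OF assms(1,2)] by simp
  \<comment> \<open>Seen from \<open>y\<close>, the two points \<open>x\<close> and
    \<open>?z\<close> of level \<open>i\<close> exchange roles.\<close>
  then have "across q i ?z y = Some (x, i)"
    using z(2) by (simp add: across_def)
  moreover have "across q i x y = Some (?z, i)"
    using \<open>?z \<noteq> x\<close> by (simp add: across_def)
  ultimately show ?thesis
    by (simp only: bose_skolem_next(2)[OF assms(3)])
qed

lemma bose_skolem_cancel_Some: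
  assumes "x < q" "y < q" "i < 3" "j < 3"
  shows "bose_skolem q (Some (x, i)) (bose_skolem q (Some (x, i)) (Some (y, j))) = Some (y, j)"
proof -
  consider "i = j" "x = y" | "i = j" "x \<noteq> y" | "j = (i + 1) mod 3" | "i = (j + 1) mod 3"
    using less_3_cases[OF assms(3)] less_3_cases[OF assms(4)] by fastforce
  then show ?thesis
  proof cases
    case 1
    then show ?thesis by simp
  next
    case 2
    then have "bose_skolem q (Some (x, i)) (bose_skolem q (Some (x, i)) (Some (y, j)))
        = across q i x (mid q x y)"
      using assms bose_skolem_next(1) by simp
    then show ?thesis using 2 assms by (simp add: across_def unmid_mid)
  next
    case 3
    then show ?thesis
      using assms bose_skolem_next(1) bose_skolem_across_left by simp
  next
    case 4
    then show ?thesis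
      using assms bose_skolem_next(2) bose_skolem_across_right by simp
  qed
qed

lemma bose_skolem_cancel_None:
  assumes "x < q" "i < 3" "even q"
  shows "bose_skolem q None (bose_skolem q None (Some (x, i))) = Some (x, i)"
    and "bose_skolem q (Some (x, i)) (bose_skolem q (Some (x, i)) None) = None"
proof -
  \<comment> \<open>Evenness puts the partner of an upper element strictly into the lower half, so
    the second application takes the opposite branch.\<close>
  have "x - q div 2 < q div 2" using assms(1,3) by (auto elim!: evenE)
  then show "bose_skolem q None (bose_skolem q None (Some (x, i))) = Some (x, i)"
    using less_3_cases[OF assms(2)] by auto
  have lt: "x + q div 2 < q" if "x < q div 2" using that assms(3) by (auto elim!: evenE)
  show "bose_skolem q (Some (x, i)) (bose_skolem q (Some (x, i)) None) = None"
    using assms lt less_3_cases[OF assms(2)] by (auto simp: across_eq mid_self)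
qed

lemma bose_skolem_cancel:
  assumes "a \<in> bose_skolem_points q" "b \<in> bose_skolem_points q"
  shows "bose_skolem q a (bose_skolem q a b) = b"
  using assms bose_skolem_cancel_Some bose_skolem_cancel_None bose_skolem.simps(1)
  unfolding bose_skolem_points_def
  by (auto simp del: bose_skolem.simps(2-4) split: if_splits)

lemma steiner_quasigroup_bose_skolem:
  "steiner_quasigroup_on (bose_skolem_points q) (bose_skolem q)"
proof -
  have "bose_skolem q a a = a" for a
    by (cases "(q, a, a)" rule: bose_skolem.cases) auto
  then show ?thesis
    unfolding steiner_quasigroup_on_def
    using bose_skolem_commute bose_skolem_closed bose_skolem_cancel by blast
qed

section \<open>Iterated blow-ups\<close>

text \<open>Vertices are words of \<open>k\<close> digits in base \<open>m\<close>, encoded as numbers below \<open>m ^ k\<close>; the lowest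
  digit names the part at the outermost level.\<close>

fun blowup :: "nat \<Rightarrow> (nat \<times> nat \<times> nat) set \<Rightarrow> nat \<Rightarrow> (nat \<times> nat \<times> nat) set" where
  "blowup m P 0 = {}"
| "blowup m P (Suc k) = {(x, y, z). x < m ^ Suc k \<and> y < m ^ Suc k \<and> z < m ^ Suc k \<and>
     (if x mod m = y mod m \<and> y mod m = z mod m
      then (x div m, y div m, z div m) \<in> blowup m P k
      else (x mod m, y mod m, z mod m) \<in> P)}"

text \<open>A 3-graph is handled as a set of ordered triples without repeated entries and closed
  under permutation, so that residues and quotients act entrywise.\<close>

definition distinct_triples :: "(nat \<times> nat \<times> nat) set \<Rightarrow> bool" where
  "distinct_triples P \<longleftrightarrow> (\<forall>x y z. (x, y, z) \<in> P \<longrightarrow> x \<noteq> y \<and> y \<noteq> z \<and> x \<noteq> z)"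

definition symmetric_triples :: "(nat \<times> nat \<times> nat) set \<Rightarrow> bool" where
  "symmetric_triples P \<longleftrightarrow> (\<forall>x y z. (x, y, z) \<in> P \<longrightarrow> (y, x, z) \<in> P \<and> (x, z, y) \<in> P)"

definition link_clique :: "(nat \<times> nat \<times> nat) set \<Rightarrow> nat \<Rightarrow> nat set \<Rightarrow> bool" where
  "link_clique P x S \<longleftrightarrow> (\<forall>y\<in>S. \<forall>z\<in>S. y \<noteq> z \<longrightarrow> (x, y, z) \<in> P)"

lemma blowup_less:
  assumes "(x, y, z) \<in> blowup m P k"
  shows "x < m ^ k \<and> y < m ^ k \<and> z < m ^ k"
  using assms by (cases k) auto

lemma distinct_triples_blowup:
  assumes "distinct_triples P"
  shows "distinct_triples (blowup m P k)"
proof (induction k)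
  case (Suc k)
  then show ?case
    using assms unfolding distinct_triples_def by (auto split: if_splits) blast+
qed (simp add: distinct_triples_def)

lemma symmetric_triplesD:
  assumes "symmetric_triples P" "(x, y, z) \<in> P"
  shows "(y, x, z) \<in> P" "(x, z, y) \<in> P"
  using assms unfolding symmetric_triples_def by blast+

lemma symmetric_triples_blowup:
  assumes "symmetric_triples P"
  shows "symmetric_triples (blowup m P k)"
proof (induction k)
  case (Suc k)
  show ?case
    unfolding symmetric_triples_def
  proof (intro allI impI)
    fix x y z assume xyz: "(x, y, z) \<in> blowup m P (Suc k)"
    show "(y, x, z) \<in> blowup m P (Suc k) \<and> (x, z, y) \<in> blowup m P (Suc k)"
    proof (cases "x mod m = y mod m \<and> y mod m = z mod m")
      case True
      then show ?thesis
        using xyz symmetric_triplesD[OF Suc, of "x div m" "y div m" "z div m"] by simp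
    next
      case False
      then show ?thesis
        using xyz symmetric_triplesD[OF assms, of "x mod m" "y mod m" "z mod m"] by auto
    qed
  qed
qed (simp add: symmetric_triples_def)

lemma finite_blowup: "finite (blowup m P k)"
  by (rule finite_subset[of _ "{..<m ^ k} \<times> {..<m ^ k} \<times> {..<m ^ k}"])
    (use blowup_less in auto)

lemma digit_less_power:
  fixes m :: nat
  assumes "x < m ^ k" "r < m"
  shows "m * x + r < m ^ Suc k"
proof -
  have "m * x + r < m * Suc x" using assms(2) by simp
  also have "\<dots> \<le> m * m ^ k" using assms(1) by (intro mult_left_mono) auto
  finally show ?thesis by simp
qed

text \<open>Two disjoint families: copies of depth \<open>k\<close> inside each part
  (\<open>?low\<close>), and, for each triple of \<open>P\<close>, all choices of one vertex from
  each of its three parts (\<open>?top\<close>).\<close>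

lemma card_blowup_Suc:
  assumes "distinct_triples P" "P \<subseteq> {..<m} \<times> {..<m} \<times> {..<m}"
  shows "m * card (blowup m P k) + card P * (m ^ k) ^ 3 \<le> card (blowup m P (Suc k))"
proof -
  let ?N = "{..<m ^ k}"
  let ?low = "\<lambda>((x, y, z), r). (m * x + r, m * y + r, m * z + r)"
  let ?top = "\<lambda>((a, b, c), (x, y, z)). (m * x + a, m * y + b, m * z + c)"
  let ?A = "?low ` (blowup m P k \<times> {..<m})"
  let ?B = "?top ` (P \<times> (?N \<times> ?N \<times> ?N))"
  have eq: "x = y \<and> r = t" if "m * x + r = m * y + t" "r < m" "t < m" for x y r t :: nat
  proof -
    have "(m * x + r) div m = x" "(m * y + t) div m = y" using that(2,3) by auto
    then have "x = y" using that(1) by simp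
    then show ?thesis using that(1) by simp
  qed
  have finP: "finite P" using assms(2) finite_subset by blast
  have cardA: "card ?A = m * card (blowup m P k)"
    by (subst card_image) (auto simp: inj_on_def card_cartesian_product dest!: eq)
  have "inj_on ?top (P \<times> (?N \<times> ?N \<times> ?N))"
    using assms(2) by (auto simp: inj_on_def dest!: eq)
  then have cardB: "card ?B = card P * (m ^ k) ^ 3"
    by (subst card_image) (auto simp: card_cartesian_product power3_eq_cube)
  \<comment> \<open>The lowest digits agree throughout a triple in \<open>?A\<close> and are
    distinct in a triple in \<open>?B\<close>.\<close>
  have "?A \<inter> ?B = {}"
  proof -
    have False if "(a, b, c) \<in> P" "r < m" "m * x + r = m * x' + a" "m * y + r = m * y' + b"
      for a b c x y x' y' r
    proof -
      have "a < m" "b < m" "a \<noteq> b" using that(1) assms by (auto simp: distinct_triples_def)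
      then show False using eq[OF that(3)] eq[OF that(4)] that(2) by simp
    qed
    then show ?thesis by fast
  qed
  moreover have "?A \<subseteq> blowup m P (Suc k)"
  proof -
    have "(m * x + r, m * y + r, m * z + r) \<in> blowup m P (Suc k)"
      if "(x, y, z) \<in> blowup m P k" "r < m" for x y z r
      using that blowup_less[OF that(1)] digit_less_power[OF _ that(2)]
      by (simp del: power_Suc)
    then show ?thesis by fast
  qed
  moreover have "?B \<subseteq> blowup m P (Suc k)"
  proof -
    have "(m * x + a, m * y + b, m * z + c) \<in> blowup m P (Suc k)"
      if "(a, b, c) \<in> P" "x < m ^ k" "y < m ^ k" "z < m ^ k" for a b c x y z
    proof -
      have "a < m" "b < m" "c < m" "a \<noteq> b"
        using that(1) assms by (auto simp: distinct_triples_def)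
      then show ?thesis
        using that digit_less_power by (simp del: power_Suc)
    qed
    then show ?thesis by fast
  qed
  moreover have "finite ?A" "finite ?B"
    using finP finite_blowup by simp_all
  ultimately have "card ?A + card ?B \<le> card (blowup m P (Suc k))"
    using card_mono[OF finite_blowup, of "?A \<union> ?B" m P "Suc k"]
    by (simp only: card_Un_disjoint Un_least)
  then show ?thesis using cardA cardB by simp
qed

text \<open>A clique in the link of \<open>x\<close> lies either inside the part of
  \<open>x\<close>, where quotients reduce the depth, or wholly outside it, where residues form a
  clique in a link of \<open>P\<close>.\<close>

lemma link_clique_blowup:
  assumes "distinct_triples P"
    and "\<And>a T. link_clique P a T \<Longrightarrow> finite T \<Longrightarrow> a \<notin> T \<Longrightarrow> T \<subseteq> {..<m} \<Longrightarrow> card T < s"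
    and "s \<ge> 2" "m > 0"
  shows "link_clique (blowup m P k) x S \<Longrightarrow> finite S \<Longrightarrow> card S < s"
proof (induction k arbitrary: x S)
  case 0
  \<comment> \<open>At depth 0 there are no triples, so cliques have at most one element; hence
    \<open>s \<ge> 2\<close>.\<close>
  have "card S \<le> 1"
    using 0 by (intro card_le_Suc0_iff_eq[THEN iffD2, unfolded One_nat_def[symmetric]])
      (auto simp: link_clique_def)
  then show ?case using assms(3) by simp
next
  case (Suc k)
  show ?case
  proof (rule ccontr)
    assume "\<not> card S < s"
    then have card: "card S \<ge> s" "card S \<ge> 2" using assms(3) by auto
    have clique: "(x, y, z) \<in> blowup m P (Suc k)" if "y \<in> S" "z \<in> S" "y \<noteq> z" for y z
      using Suc.prems(1) that by (auto simp: link_clique_def)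
    show False
    proof (cases "\<exists>y\<in>S. y mod m = x mod m")
      case True
      then obtain y where y: "y \<in> S" "y mod m = x mod m" by blast
      \<comment> \<open>Since \<open>x\<close> and \<open>y\<close> share a residue, a
        \<open>z\<close> with another residue would put a triple with a repeated entry into
        \<open>P\<close>.\<close>
      have res: "z mod m = x mod m" if "z \<in> S" for z
        using clique[OF y(1) that] y assms(1)
        by (cases "z = y") (auto simp: distinct_triples_def split: if_splits)
      have inj: "inj_on (\<lambda>z. z div m) S"
        by (rule inj_onI) (metis res div_mult_mod_eq)
      have "link_clique (blowup m P k) (x div m) ((\<lambda>z. z div m) ` S)"
        unfolding link_clique_def using clique res by (auto split: if_splits)
      then have "card ((\<lambda>z. z div m) ` S) < s"
        using Suc.IH Suc.prems(2) by blast
      then show False using card_image[OF inj] card by simp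
    next
      case False
      have P: "(x mod m, y mod m, z mod m) \<in> P" if "y \<in> S" "z \<in> S" "y \<noteq> z" for y z
        using clique[OF that] False that by (auto split: if_splits)
      have inj: "inj_on (\<lambda>z. z mod m) S"
      proof (rule inj_onI, rule ccontr)
        fix y z assume "y \<in> S" "z \<in> S" "y mod m = z mod m" "y \<noteq> z"
        then show False using P[of y z] assms(1) unfolding distinct_triples_def by blast
      qed
      have "link_clique P (x mod m) ((\<lambda>z. z mod m) ` S)"
        unfolding link_clique_def using P by fast
      moreover have "x mod m \<notin> (\<lambda>z. z mod m) ` S"
        using False by force
      moreover have "(\<lambda>z. z mod m) ` S \<subseteq> {..<m}"
        using assms(4) by auto
      ultimately have "card ((\<lambda>z. z mod m) ` S) < s"
        using assms(2) Suc.prems(2) by blast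
      then show False using card_image[OF inj] card by simp
    qed
  qed
qed

section \<open>From ordered triples to 3-graphs\<close>

definition triple_graph :: "nat \<Rightarrow> (nat \<times> nat \<times> nat) set \<Rightarrow> nat hypergraph" where
  "triple_graph n P = ({..<n}, (\<lambda>(x, y, z). {x, y, z}) ` P)"

lemma uniform_triple_graph:
  assumes "distinct_triples P" "P \<subseteq> {..<n} \<times> {..<n} \<times> {..<n}"
  shows "uniform_graph 3 (triple_graph n P)"
  using assms by (fastforce simp: uniform_graph_def triple_graph_def nsets_def distinct_triples_def)

lemma permuted_triple:
  assumes "{x, y, z} = {a, b, c}" "x \<noteq> y" "y \<noteq> z" "x \<noteq> z"
  shows "(x, y, z) \<in> {(a, b, c), (a, c, b), (b, a, c), (b, c, a), (c, a, b), (c, b, a)}"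
proof -
  have "x \<in> {a, b, c}" "y \<in> {a, b, c}" "z \<in> {a, b, c}"
    using assms(1) by blast+
  then show ?thesis
    using assms(2-4) by simp (elim disjE; simp)
qed

text \<open>An edge forgets the order of its triple; symmetry restores any ordering.\<close>

lemma symmetric_triples_set_eq:
  assumes "distinct_triples P" "symmetric_triples P" "(a, b, c) \<in> P"
    and "{x, y, z} = {a, b, c}" "x \<noteq> y" "y \<noteq> z" "x \<noteq> z"
  shows "(x, y, z) \<in> P"
proof -
  have "{(a, b, c), (a, c, b), (b, a, c), (b, c, a), (c, a, b), (c, b, a)} \<subseteq> P"
    using assms(2,3) unfolding symmetric_triples_def by blast
  then show ?thesis
    using permuted_triple[OF assms(4-7)] by blast
qed

text \<open>The fibre over an edge consists of orderings of its three vertices.\<close>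

lemma card_triple_graph:
  assumes "distinct_triples P" "finite P"
  shows "card P \<le> 6 * card (edges (triple_graph n P))"
proof -
  let ?set = "\<lambda>(x, y, z). {x, y, z :: nat}"
  have "card {p \<in> P. ?set p = e} \<le> 6" if "e \<in> ?set ` P" for e
  proof -
    from that obtain p where "p \<in> P" "e = ?set p" by (elim imageE)
    then obtain a b c where abc: "(a, b, c) \<in> P" "e = {a, b, c}" by (cases p) simp
    have "{p \<in> P. ?set p = e} \<subseteq> set [(a, b, c), (a, c, b), (b, a, c), (b, c, a), (c, a, b), (c, b, a)]"
    proof
      fix p assume p: "p \<in> {p \<in> P. ?set p = e}"
      then obtain x y z where xyz: "p = (x, y, z)" "{x, y, z} = {a, b, c}"
        using abc by (cases p) simp
      then have "x \<noteq> y" "y \<noteq> z" "x \<noteq> z"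
        using p assms(1) unfolding distinct_triples_def by blast+
      then show "p \<in> set [(a, b, c), (a, c, b), (b, a, c), (b, c, a), (c, a, b), (c, b, a)]"
        using permuted_triple[OF xyz(2)] xyz(1) by simp
    qed
    then have "card {p \<in> P. ?set p = e} \<le> card (set [(a, b, c), (a, c, b), (b, a, c), (b, c, a), (c, a, b), (c, b, a)])"
      by (intro card_mono) auto
    also have "\<dots> \<le> 6" by (rule order_trans[OF card_length]) simp
    finally show ?thesis .
  qed
  then have "(\<Sum>e\<in>?set ` P. card {p \<in> P. ?set p = e}) \<le> (\<Sum>e\<in>?set ` P. 6)"
    by (rule sum_mono)
  moreover have "card P = (\<Sum>e\<in>?set ` P. card {p \<in> P. ?set p = e})"
    using sum.image_gen[OF assms(2), of "\<lambda>_. 1::nat" ?set] by simp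
  ultimately show ?thesis by (simp add: triple_graph_def)
qed

text \<open>The image of \<open>None\<close> serves as \<open>x\<close>, the images of the
  \<open>Some i\<close> as \<open>S\<close>. Injectivity of the embedding makes the three vertices
  of an edge distinct, so their order can be recovered.\<close>

lemma contains_suspension_complete_graph:
  assumes "contains (triple_graph n P) (suspension (complete_graph s))"
    and "distinct_triples P" "symmetric_triples P"
  obtains x S where "link_clique P x S" "finite S" "card S = s"
proof -
  obtain H f where H: "subgraph H (triple_graph n P)"
    "bij_betw f (verts (suspension (complete_graph s))) (verts H)"
    "edges H = (`) f ` edges (suspension (complete_graph s))"
    using assms(1) unfolding contains_def isomorphic_def by blast
  have inj: "inj_on (\<lambda>i. f (Some i)) {..<s}"
    using H(2) unfolding bij_betw_def suspension_def complete_graph_def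
    by (auto simp: inj_on_def)
  have "(f None, f (Some i), f (Some j)) \<in> P" if "i < s" "j < s" "i \<noteq> j" for i j
  proof -
    have "{i, j} \<in> nsets {..<s} 2" using that by (simp add: nsets_def)
    then have "insert None (Some ` {i, j}) \<in> edges (suspension (complete_graph s))"
      unfolding suspension_def complete_graph_def snd_conv by (rule imageI)
    then have "f ` insert None (Some ` {i, j}) \<in> edges (triple_graph n P)"
      using H(1,3) unfolding subgraph_def by blast
    then obtain x y z where "(x, y, z) \<in> P" "{x, y, z} = {f None, f (Some i), f (Some j)}"
      by (auto simp: triple_graph_def)
    moreover have "f None \<noteq> f (Some i)" "f None \<noteq> f (Some j)" "f (Some i) \<noteq> f (Some j)"
      using H(2) that unfolding bij_betw_def suspension_def complete_graph_def
      by (auto simp: inj_on_def)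
    ultimately show ?thesis
      using symmetric_triples_set_eq[OF assms(2,3)] by metis
  qed
  then have "link_clique P (f None) ((\<lambda>i. f (Some i)) ` {..<s})"
    by (auto simp: link_clique_def)
  moreover have "card ((\<lambda>i. f (Some i)) ` {..<s}) = s"
    using card_image[OF inj] by simp
  ultimately show ?thesis using that by blast
qed

section \<open>The complement of a Steiner triple system\<close>

definition nonblocks :: "nat \<Rightarrow> (nat \<Rightarrow> nat \<Rightarrow> nat) \<Rightarrow> (nat \<times> nat \<times> nat) set" where
  "nonblocks m f = {(a, b, c). a < m \<and> b < m \<and> c < m \<and> a \<noteq> b \<and> b \<noteq> c \<and> a \<noteq> c \<and> f a b \<noteq> c}"

lemma distinct_nonblocks: "distinct_triples (nonblocks m f)"
  by (auto simp: distinct_triples_def nonblocks_def)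

context
  fixes m :: nat and f :: "nat \<Rightarrow> nat \<Rightarrow> nat"
  assumes steiner: "steiner_quasigroup_on {..<m} f"
begin

lemma third_point:
  assumes "a < m" "b < m"
  shows "f a a = a" "f a b < m" "f a b = f b a" "f a (f a b) = b"
  using steiner assms unfolding steiner_quasigroup_on_def by blast+

lemma third_point_neq:
  assumes "a < m" "b < m" "a \<noteq> b"
  shows "f a b \<noteq> a" "f a b \<noteq> b"
  using third_point assms by metis+

lemma symmetric_nonblocks: "symmetric_triples (nonblocks m f)"
  unfolding symmetric_triples_def
proof (intro allI impI)
  fix a b c assume "(a, b, c) \<in> nonblocks m f"
  then have abc: "a < m" "b < m" "c < m" "a \<noteq> b" "b \<noteq> c" "a \<noteq> c" "f a b \<noteq> c"
    by (auto simp: nonblocks_def)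
  have "f b a \<noteq> c" "f a c \<noteq> b"
    using third_point(3)[of a b] third_point(4)[of a c] abc by auto
  then show "(b, a, c) \<in> nonblocks m f \<and> (a, c, b) \<in> nonblocks m f"
    using abc by (auto simp: nonblocks_def)
qed

text \<open>After \<open>a\<close> and \<open>b\<close>, the last entry must avoid the three
  distinct points \<open>a\<close>, \<open>b\<close> and \<open>f a b\<close>.\<close>

lemma card_nonblocks: "card (nonblocks m f) = m * (m - 1) * (m - 3)"
proof -
  have eq: "nonblocks m f = (SIGMA a:{..<m}. SIGMA b:{..<m} - {a}. {..<m} - {a, b, f a b})"
    by (auto simp: nonblocks_def)
  have "card ({..<m} - {a, b, f a b}) = m - 3" if "a < m" "b < m" "a \<noteq> b" for a b
    using third_point(2) third_point_neq[OF that] that by (subst card_Diff_subset) auto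
  then have "card (SIGMA b:{..<m} - {a}. {..<m} - {a, b, f a b}) = (m - 1) * (m - 3)"
    if "a < m" for a
    using that by (subst card_SigmaI) (auto simp: card_Diff_subset)
  then show ?thesis
    unfolding eq by (subst card_SigmaI) (auto simp: mult.assoc)
qed

text \<open>The blocks through \<open>a\<close> match up the remaining points, and a clique in the link of \<open>a\<close> uses at
  most one point of each pair.\<close>

lemma link_clique_nonblocks:
  assumes "link_clique (nonblocks m f) a T" "finite T" "a \<notin> T" "T \<subseteq> {..<m}" "a < m"
  shows "2 * card T < m"
proof -
  have lt: "b < m" "b \<noteq> a" if "b \<in> T" for b
    using assms that by auto
  have out: "f a b \<notin> T" if "b \<in> T" for b
  proof
    assume "f a b \<in> T"
    then have "(a, b, f a b) \<in> nonblocks m f"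
      using assms(1) that third_point_neq(2)[of a b] lt[OF that] assms(5)
      unfolding link_clique_def by metis
    then show False by (simp add: nonblocks_def)
  qed
  have "inj_on (f a) T"
  proof (rule inj_onI)
    fix b c assume "b \<in> T" "c \<in> T" "f a b = f a c"
    then show "b = c"
      using third_point(4)[OF assms(5)] lt(1) by metis
  qed
  then have "card (T \<union> f a ` T) = 2 * card T"
    using out assms(2) by (subst card_Un_disjoint) (auto simp: card_image)
  moreover have "T \<union> f a ` T \<subseteq> {..<m} - {a}"
  proof -
    have "f a b < m \<and> f a b \<noteq> a" if "b \<in> T" for b
      using third_point(2) third_point_neq(1) lt[OF that] assms(5) by metis
    then show ?thesis using lt by auto
  qed
  then have "card (T \<union> f a ` T) \<le> card ({..<m} - {a})"
    by (intro card_mono) auto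
  moreover have "card ({..<m} - {a}) < m"
    using assms(5) by (simp add: card_Diff_subset)
  ultimately show ?thesis by simp
qed

text \<open>With \<open>n = m ^ k\<close>, the value \<open>(m - 3) * (n ^ 3 - n) / (m + 1)\<close>
  solves the recurrence \<open>r' = m * r + m * (m - 1) * (m - 3) * n ^ 3\<close> behind
  \<open>card_blowup_Suc\<close>, because \<open>m ^ 3 - m = (m - 1) * m * (m + 1)\<close>.\<close>

lemma card_blowup_nonblocks:
  assumes "m \<ge> 3"
  shows "(real m - 3) * (real (m ^ k) ^ 3 - real (m ^ k))
    \<le> (real m + 1) * real (card (blowup m (nonblocks m f) k))"
proof (induction k)
  case (Suc k)
  let ?P = "nonblocks m f" and ?n = "real (m ^ k)"
  let ?r = "\<lambda>k. real (card (blowup m ?P k))"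
  have "real (m * card (blowup m ?P k) + card ?P * (m ^ k) ^ 3) \<le> ?r (Suc k)"
    by (rule of_nat_mono, rule card_blowup_Suc[OF distinct_nonblocks]) (auto simp: nonblocks_def)
  then have "real m * ?r k + real m * (real m - 1) * (real m - 3) * ?n ^ 3 \<le> ?r (Suc k)"
    using assms by (simp add: card_nonblocks of_nat_diff)
  then have "(real m + 1) * (real m * ?r k + real m * (real m - 1) * (real m - 3) * ?n ^ 3)
      \<le> (real m + 1) * ?r (Suc k)"
    by (intro mult_left_mono) auto
  moreover have "real m * ((real m - 3) * (?n ^ 3 - ?n)) \<le> real m * ((real m + 1) * ?r k)"
    by (intro mult_left_mono Suc.IH) auto
  moreover have "real m * ((real m - 3) * (?n ^ 3 - ?n))
      + (real m + 1) * (real m * (real m - 1) * (real m - 3) * ?n ^ 3)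
      = (real m - 3) * ((real m * ?n) ^ 3 - real m * ?n)"
    by (simp add: algebra_simps power3_eq_cube)
  ultimately show ?case
    by (simp add: algebra_simps)
qed simp

end

section \<open>The density bound\<close>

lemma real_choose_3:
  "real (n choose 3) = real n * (real n - 1) * (real n - 2) / 6"
  by (simp add: binomial_gbinomial gbinomial_prod_rev eval_nat_numeral algebra_simps)

lemma edges_suspension_complete_graph:
  assumes "s \<ge> 2"
  shows "edges (suspension (complete_graph s)) \<noteq> {}"
proof -
  have "{0, 1} \<in> nsets {..<s} 2" using assms by (simp add: nsets_def)
  then show ?thesis
    unfolding suspension_def complete_graph_def snd_conv image_is_empty by blast
qed

lemma turan_density_ge_steiner:
  assumes "steiner_quasigroup_on {..<m} f" "m = 2 * s - 1" "s \<ge> 2"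
  shows "turan_density (suspension (complete_graph s)) \<ge> 1 - 2 / real s"
proof (rule turan_density_ge[OF edges_suspension_complete_graph[OF assms(3)]])
  fix N :: nat
  let ?F = "suspension (complete_graph s)"
  let ?P = "nonblocks m f"
  \<comment> \<open>A positive exponent gives \<open>n \<ge> m \<ge> 3\<close>, and
    \<open>k < m ^ k\<close> gives \<open>n \<ge> N\<close>.\<close>
  define k where "k = Suc N"
  define n where "n = m ^ k"
  let ?R = "blowup m ?P k"
  have m: "m \<ge> 3" using assms by simp
  have "k < n" unfolding n_def using m by (intro power_gt_expt) simp
  then have "n \<ge> N" by (simp add: k_def)
  moreover have "m * 1 \<le> n" unfolding n_def k_def power_Suc using m by (intro mult_left_mono) auto
  then have "n \<ge> 3" using m by simp
  ultimately have n: "n \<ge> N" "n \<ge> 3" by blast+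
  have R: "distinct_triples ?R" "symmetric_triples ?R"
    using distinct_triples_blowup distinct_nonblocks symmetric_triples_blowup
      symmetric_nonblocks[OF assms(1)] by blast+
  have "card S < s" if S: "link_clique ?R x S" "finite S" for x S
  proof (rule link_clique_blowup[OF distinct_nonblocks _ assms(3) _ S])
    fix a T assume T: "link_clique ?P a T" "finite T" "a \<notin> T" "T \<subseteq> {..<m}"
    show "card T < s"
    proof (cases "a < m")
      case True
      then show ?thesis using link_clique_nonblocks[OF assms(1) T] assms(2) by simp
    next
      case False
      \<comment> \<open>Out of range, \<open>a\<close> lies in no triple of \<open>?P\<close>, so a
        clique in its link has at most one point.\<close>
      then have "card T \<le> Suc 0"
        using T by (subst card_le_Suc0_iff_eq) (auto simp: link_clique_def nonblocks_def)
      then show ?thesis using assms(3) by simp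
    qed
  qed (use m in simp)
  then have "\<not> contains (triple_graph n ?R) ?F"
    using contains_suspension_complete_graph[OF _ R] by (metis less_irrefl)
  moreover have "uniform_graph 3 (triple_graph n ?R)"
    using R(1) by (rule uniform_triple_graph) (use blowup_less in \<open>auto simp: n_def\<close>)
  ultimately have "card (edges (triple_graph n ?R)) \<le> turan_number n ?F"
    using card_edges_le_turan_number[of "triple_graph n ?R" ?F] by (simp add: triple_graph_def)
  then have "card ?R \<le> 6 * turan_number n ?F"
    using card_triple_graph[OF R(1) finite_blowup, of n] by linarith
  then have R_le: "real (card ?R) \<le> 6 * real (turan_number n ?F)"
    by linarith
  have s: "real m = 2 * real s - 1" using assms by (simp add: of_nat_diff)
  have "2 * ((real s - 2) * (real n ^ 3 - real n)) \<le> 2 * (real s * real (card ?R))"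
    using card_blowup_nonblocks[OF assms(1) m, of k] unfolding n_def[symmetric] s
    by (simp add: algebra_simps)
  moreover have "real s * real (card ?R) \<le> real s * (6 * real (turan_number n ?F))"
    using R_le by (intro mult_left_mono) auto
  \<comment> \<open>\<open>6 * (n choose 3)\<close> falls short of \<open>n ^ 3 - n\<close> by
    \<open>3 * n * (n - 1)\<close>, so the bound holds at this \<open>n\<close> itself, without an
    error term.\<close>
  moreover have "(real s - 2) * (real n * (real n - 1) * (real n - 2)) \<le> (real s - 2) * (real n ^ 3 - real n)"
    using assms(3) n by (intro mult_left_mono) (auto simp: power3_eq_cube algebra_simps)
  ultimately have "(real s - 2) * real (n choose 3) \<le> real s * real (turan_number n ?F)"
    unfolding real_choose_3 by simp
  moreover have "real (n choose 3) > 0" using n by simp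
  ultimately have "1 - 2 / real s \<le> real (turan_number n ?F) / real (n choose 3)"
    using assms(3) by (simp add: field_simps)
  then show "\<exists>n\<ge>N. 1 - 2 / real s \<le> real (turan_number n ?F) / real (n choose 3)"
    using n by blast
qed

theorem corollary17:
  fixes s :: nat
  assumes "s \<ge> 2"
    and "s mod 3 = 1 \<or> s mod 3 = 2"
  shows "turan_density (suspension (complete_graph s)) \<ge> 1 - 2 / real s"
proof -
  \<comment> \<open>If \<open>s mod 3 = 2\<close>, then \<open>q\<close> is odd and
    \<open>3 * q = 2 * s - 1\<close> (Bose); if \<open>s mod 3 = 1\<close>, then \<open>q\<close> is
    even and \<open>None\<close> supplies the one missing point (Skolem).\<close>
  define q where "q = (2 * s - 1) div 3"
  have "3 * q + (if even q then 1 else 0) = 2 * s - 1"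
    using assms unfolding q_def by presburger
  then have "card (bose_skolem_points q) = 2 * s - 1"
    using card_bose_skolem_points(2) by simp
  then obtain f where "steiner_quasigroup_on {..<2 * s - 1} f"
    using steiner_quasigroup_on_transfer[OF steiner_quasigroup_bose_skolem[of q]
      card_bose_skolem_points(1)] by metis
  then show ?thesis using assms(1) turan_density_ge_steiner by blast
qed

end
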